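(* Let $h:\mathbb{B}^4\times\mathbb{B}^k\to\mathbb{R}$ be in $\mathcal{F}^2$ and contain no bilinear terms $z_iz_j$ between auxiliary variables, i.e. $h(\mathbf{x},\mathbf{z})=q(\mathbf{x})+\sum_{l=1}^k\big(g_l-\sum_{i=1}^4g_{l,i}x_i\big)z_l$ with $q\in\mathcal{F}^2$ and $g_{l,i}\ge0$. Then there exist $q'\in\mathcal{F}^2$ and affine functions $\kappa_f(\mathbf{x})=g_f-\sum_ig_{f,i}x_i$, $\kappa_b(\mathbf{x})=g_b-\sum_ig_{b,i}x_i$ with all $g_{f,i},g_{b,i}\ge0$ such that $h'(\mathbf{x},z_f,z_b)=q'(\mathbf{x})+\kappa_f(\mathbf{x})z_f+\kappa_b(\mathbf{x})z_b\in\mathcal{F}^2$ satisfies $\min_{z_f,z_b}h'(\mathbf{x},z_f,z_b)=\min_{\mathbf{z}\in\mathbb{B}^k}h(\mathbf{x},\mathbf{z})$ for all $\mathbf{x}\in\mathbb{B}^4$, where $\kappa_f(S)\ge0$ for $|S|\le2$, $\kappa_f(S)\le0$ for $|S|\ge3$, $\kappa_b(S)\ge0$ for $|S|\le1$, and $\kappa_b(S)\le0$ for $|S|\ge2$.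
   Context: $\mathbb{B}=\{0,1\}$. $\mathcal{F}^2$: submodular pseudo-Boolean functions of order $\le2$ (multilinear polynomials of degree $\le2$ with non-positive bilinear coefficients). Labelings $\mathbf{x}\in\mathbb{B}^4$ are identified with $S=\{i:x_i=1\}\subseteq\{1,2,3,4\}$. The sign conditions on $\kappa_f,\kappa_b$ express that $z_f$ and $z_b$ are associated with the forward reference partition (sets of size $\ge3$ versus the rest) and the backward reference partition (sets of size $\ge2$ versus the rest). *)

theory Defs
  imports Complex_Main "HOL-Library.Indicator_Function"
begin

text \<open>
  A labeling of a finite index set \<open>V\<close> by \<open>{0, 1}\<close> is represented by the subset \<open>x\<close> of the indices
  labeled 1, so the value of the variable \<open>i\<close> is \<open>indicator x i\<close> and a pseudo-Boolean function is a
  function \<open>'v set \<Rightarrow> real\<close> of which only the values on subsets of \<open>V\<close> matter. Meet and join of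
  labelings are intersection and union.
\<close>

definition quad_poly :: "'v set \<Rightarrow> real \<Rightarrow> ('v \<Rightarrow> real) \<Rightarrow> ('v set \<Rightarrow> real) \<Rightarrow> 'v set \<Rightarrow> real" where
  "quad_poly V c a b x =
     c + (\<Sum>i\<in>V. a i * indicator x i)
       + (\<Sum>e | e \<subseteq> V \<and> card e = 2. b e * (\<Prod>i\<in>e. indicator x i))"

definition order_le_2 :: "'v set \<Rightarrow> ('v set \<Rightarrow> real) \<Rightarrow> bool" where
  "order_le_2 V f \<longleftrightarrow> (\<exists>c a b. \<forall>x\<subseteq>V. f x = quad_poly V c a b x)"

definition submodular_on :: "'v set \<Rightarrow> ('v set \<Rightarrow> real) \<Rightarrow> bool" where
  "submodular_on V f \<longleftrightarrow> (\<forall>x\<subseteq>V. \<forall>y\<subseteq>V. f (x \<inter> y) + f (x \<union> y) \<le> f x + f y)"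

definition F2 :: "'v set \<Rightarrow> ('v set \<Rightarrow> real) set" where
  "F2 V = {f. order_le_2 V f \<and> submodular_on V f}"

text \<open>
  A function of two blocks of variables, viewed as a function of the disjoint union of the blocks.
\<close>

definition joint :: "('v set \<Rightarrow> 'w set \<Rightarrow> real) \<Rightarrow> ('v + 'w) set \<Rightarrow> real" where
  "joint h u = h (Inl -` u) (Inr -` u)"

datatype aux = Fwd | Bwd

text \<open>
  Functions in \<open>F2\<close> are exactly the multilinear polynomials of degree at most 2 with non-positive
  bilinear coefficients.
\<close>

lemma prod_indicator_eq:
  assumes "finite e"
  shows "(\<Prod>i\<in>e. indicator x i :: real) = of_bool (e \<subseteq> x)"
  using assms by induction (auto simp: indicator_def)

lemma quad_poly_alt:
  assumes "finite V"
  shows "quad_poly V c a b x =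
     c + (\<Sum>i\<in>V. a i * indicator x i) + (\<Sum>e | e \<subseteq> V \<and> card e = 2. b e * of_bool (e \<subseteq> x))"
proof -
  have "(\<Sum>e | e \<subseteq> V \<and> card e = 2. b e * (\<Prod>i\<in>e. indicator x i)) =
        (\<Sum>e | e \<subseteq> V \<and> card e = 2. b e * of_bool (e \<subseteq> x))"
    using assms by (intro sum.cong refl) (auto simp: prod_indicator_eq finite_subset)
  then show ?thesis
    unfolding quad_poly_def by simp
qed

lemma quad_poly_submodular:
  assumes "finite V" and b: "\<And>e. e \<subseteq> V \<Longrightarrow> card e = 2 \<Longrightarrow> b e \<le> 0"
  shows "submodular_on V (quad_poly V c a b)"
  unfolding submodular_on_def
proof (intro allI impI)
  fix x y
  have "(\<Sum>i\<in>V. a i * indicator (x \<inter> y) i) + (\<Sum>i\<in>V. a i * indicator (x \<union> y) i) =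
        (\<Sum>i\<in>V. a i * indicator x i) + (\<Sum>i\<in>V. a i * indicator y i)"
    unfolding sum.distrib[symmetric] by (intro sum.cong) (auto simp: indicator_def)
  moreover have
    "(\<Sum>e | e \<subseteq> V \<and> card e = 2. b e * of_bool (e \<subseteq> x \<inter> y)) +
     (\<Sum>e | e \<subseteq> V \<and> card e = 2. b e * of_bool (e \<subseteq> x \<union> y)) \<le>
     (\<Sum>e | e \<subseteq> V \<and> card e = 2. b e * of_bool (e \<subseteq> x)) +
     (\<Sum>e | e \<subseteq> V \<and> card e = 2. b e * of_bool (e \<subseteq> y))"
    unfolding sum.distrib[symmetric] using b by (intro sum_mono) (auto simp: of_bool_def)
  ultimately show "quad_poly V c a b (x \<inter> y) + quad_poly V c a b (x \<union> y)
      \<le> quad_poly V c a b x + quad_poly V c a b y"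
    unfolding quad_poly_alt[OF assms(1)] by linarith
qed

lemma submodular_quad_poly_coeff:
  assumes "finite V" and sub: "submodular_on V (quad_poly V c a b)"
    and e: "e \<subseteq> V" "card e = 2"
  shows "b e \<le> 0"
proof -
  obtain i j where ij: "e = {i, j}" "i \<noteq> j"
    using e(2) by (auto simp: card_2_iff)
  let ?E = "{e. e \<subseteq> V \<and> card e = 2}"
  have small: "(\<Sum>d\<in>?E. b d * of_bool (d \<subseteq> x)) = 0" if x: "finite x" "card x \<le> 1" for x
  proof (intro sum.neutral ballI)
    fix d assume "d \<in> ?E"
    then have "\<not> d \<subseteq> x"
      using x card_mono[of x d] by auto
    then show "b d * of_bool (d \<subseteq> x) = 0" by simp
  qed
  have "(\<Sum>d\<in>?E. b d * of_bool (d \<subseteq> e)) = (\<Sum>d\<in>?E. if d = e then b e else 0)"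
  proof (intro sum.cong refl)
    fix d assume "d \<in> ?E"
    moreover have "finite e" using ij by simp
    ultimately have "d \<subseteq> e \<longleftrightarrow> d = e"
      using e(2) card_subset_eq[of e d] by auto
    then show "b d * of_bool (d \<subseteq> e) = (if d = e then b e else 0)" by simp
  qed
  also have "\<dots> = b e"
    using assms(1) e by (simp add: sum.delta)
  finally have big: "(\<Sum>d\<in>?E. b d * of_bool (d \<subseteq> {i, j})) = b e"
    by (simp add: ij)
  have lin: "(\<Sum>v\<in>V. a v * indicator {i, j} v) =
      (\<Sum>v\<in>V. a v * indicator {i} v) + (\<Sum>v\<in>V. a v * indicator {j} v)"
    unfolding sum.distrib[symmetric] using ij by (intro sum.cong) (auto simp: indicator_def)
  have "{i} \<subseteq> V" "{j} \<subseteq> V" using e ij by auto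
  then have "quad_poly V c a b ({i} \<inter> {j}) + quad_poly V c a b ({i} \<union> {j})
      \<le> quad_poly V c a b {i} + quad_poly V c a b {j}"
    using sub unfolding submodular_on_def by blast
  moreover have "{i} \<inter> {j} = {}" "{i} \<union> {j} = {i, j}" using ij by auto
  ultimately show ?thesis
    unfolding quad_poly_alt[OF assms(1)] using small[of "{}"] small[of "{i}"] small[of "{j}"] big lin
    by simp
qed

lemma submodular_on_cong:
  assumes "\<forall>x\<subseteq>V. f x = g x"
  shows "submodular_on V f \<longleftrightarrow> submodular_on V g"
proof -
  have "f (x \<inter> y) = g (x \<inter> y)" "f (x \<union> y) = g (x \<union> y)" "f x = g x" "f y = g y"
    if "x \<subseteq> V" "y \<subseteq> V" for x y
    using assms that by (auto simp: le_infI1)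
  then show ?thesis
    unfolding submodular_on_def by auto
qed

lemma F2_iff:
  assumes "finite V"
  shows "f \<in> F2 V \<longleftrightarrow> (\<exists>c a b. (\<forall>e\<subseteq>V. card e = 2 \<longrightarrow> b e \<le> 0) \<and> (\<forall>x\<subseteq>V. f x = quad_poly V c a b x))"
    (is "_ \<longleftrightarrow> ?R")
proof
  assume f: "f \<in> F2 V"
  then obtain c a b where eq: "\<forall>x\<subseteq>V. f x = quad_poly V c a b x"
    unfolding F2_def order_le_2_def by blast
  moreover have "submodular_on V (quad_poly V c a b)"
    using f submodular_on_cong[OF eq] by (simp add: F2_def)
  ultimately show ?R
    using submodular_quad_poly_coeff[OF assms] by blast
next
  assume ?R
  then obtain c a b where b: "\<forall>e\<subseteq>V. card e = 2 \<longrightarrow> b e \<le> 0"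
    and eq: "\<forall>x\<subseteq>V. f x = quad_poly V c a b x"
    by blast
  then show "f \<in> F2 V"
    using quad_poly_submodular[OF assms, of b c a] submodular_on_cong[OF eq]
    unfolding F2_def order_le_2_def by blast
qed

end

theory Submission
  imports Defs
begin

text \<open>
  Minimising over the auxiliary variables turns \<open>h\<close> into \<open>q\<close> plus a sum of threshold functions
  \<open>min 0 (g - sum a x)\<close>. By the sign conditions, each of the two required switches is on
  exactly for the labelings of a prescribed size, so its minimum is additive in the
  coefficients. Hence the functions of the desired form are closed under addition, and it suffices
  to treat a single threshold function. Up to an affine function one may replace
  \<open>a i\<close> by \<open>min (a i) g\<close>, and one may sort the weights, which leaves a case distinction on
  which pairs of weights exceed \<open>g\<close>: it gives the backward switch explicitly, the forward switch is
  determined by what remains in degrees 3 and 4, and the remaining pair coefficients are nonpositive.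
\<close>

section \<open>Affine switches for four weights\<close>

text \<open>
  The numbers \<open>r1\<close> to \<open>r4\<close> are the values prescribed on the triples omitting the respective
  index, and \<open>r\<close> is the value prescribed on the full set.
\<close>

lemma forward_affine:
  fixes r r1 r2 r3 r4 :: real
  assumes "r1 \<le> 0" "r2 \<le> 0" "r3 \<le> 0" "r4 \<le> 0"
    and "r \<le> r1 + r2" "r \<le> r1 + r3" "r \<le> r1 + r4" "r \<le> r2 + r3" "r \<le> r2 + r4" "r \<le> r3 + r4"
  obtains f1 f2 f3 f4 G :: real
  where "0 \<le> f1" "0 \<le> f2" "0 \<le> f3" "0 \<le> f4"
    and "f1 + f2 \<le> G" "f1 + f3 \<le> G" "f1 + f4 \<le> G" "f2 + f3 \<le> G" "f2 + f4 \<le> G" "f3 + f4 \<le> G"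
    and "G - f2 - f3 - f4 = r1" "G - f1 - f3 - f4 = r2" "G - f1 - f2 - f4 = r3" "G - f1 - f2 - f3 = r4"
    and "G - f1 - f2 - f3 - f4 = r"
proof -
  \<comment> \<open>Subtracting the full-set equation from the four triple equations forces the
    weights \<open>r1 - r\<close> to \<open>r4 - r\<close>; this \<open>G\<close> then solves the
    full-set equation. The pair bounds hold since, for instance,
    \<open>G - f1 - f2 = r3 + r4 - r\<close>.\<close>
  define G where "G = r1 + r2 + r3 + r4 - 3 * r"
  show thesis
    by (rule that[of "r1 - r" "r2 - r" "r3 - r" "r4 - r" G]) (use assms in \<open>auto simp: G_def\<close>)
qed

text \<open>
  The last two groups of inequalities are what \<open>forward_affine\<close> demands of the difference of the
  threshold function and the backward switch, after its second-order part has been removed.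
\<close>

lemma backward_affine:
  fixes g a1 a2 a3 a4 :: real
  assumes sorted: "0 \<le> a1" "a1 \<le> a2" "a2 \<le> a3" "a3 \<le> a4" "a4 \<le> g"
  defines "m \<equiv> \<lambda>s. min 0 (g - s)"
  obtains G b1 b2 b3 b4 :: real
  where "G \<le> b1 + b2" "G \<le> b1 + b3" "G \<le> b1 + b4" "G \<le> b2 + b3" "G \<le> b2 + b4" "G \<le> b3 + b4"
    and "b1 \<le> G" "b2 \<le> G" "b3 \<le> G" "b4 \<le> G"
    and "m (a1 + a2) \<le> G - b1 - b2" "m (a1 + a3) \<le> G - b1 - b3"
      "m (a1 + a4) \<le> G - b1 - b4" "m (a2 + a3) \<le> G - b2 - b3"
      "m (a2 + a4) \<le> G - b2 - b4" "m (a3 + a4) \<le> G - b3 - b4"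
    and "m (a1 + a2 + a3 + a4) + m (a3 + a4) + (G - b1 - b2) \<le> m (a2 + a3 + a4) + m (a1 + a3 + a4) + m (a1 + a2)"
      "m (a1 + a2 + a3 + a4) + m (a2 + a4) + (G - b1 - b3) \<le> m (a2 + a3 + a4) + m (a1 + a2 + a4) + m (a1 + a3)"
      "m (a1 + a2 + a3 + a4) + m (a2 + a3) + (G - b1 - b4) \<le> m (a2 + a3 + a4) + m (a1 + a2 + a3) + m (a1 + a4)"
      "m (a1 + a2 + a3 + a4) + m (a1 + a4) + (G - b2 - b3) \<le> m (a1 + a3 + a4) + m (a1 + a2 + a4) + m (a2 + a3)"
      "m (a1 + a2 + a3 + a4) + m (a1 + a3) + (G - b2 - b4) \<le> m (a1 + a3 + a4) + m (a1 + a2 + a3) + m (a2 + a4)"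
      "m (a1 + a2 + a3 + a4) + m (a1 + a2) + (G - b3 - b4) \<le> m (a1 + a2 + a4) + m (a1 + a2 + a3) + m (a3 + a4)"
    and "m (a1 + a2 + a3) + 2 * G \<le> m (a1 + a2) + m (a1 + a3) + m (a2 + a3) + (b1 + b2 + b3)"
      "m (a1 + a2 + a4) + 2 * G \<le> m (a1 + a2) + m (a1 + a4) + m (a2 + a4) + (b1 + b2 + b4)"
      "m (a1 + a3 + a4) + 2 * G \<le> m (a1 + a3) + m (a1 + a4) + m (a3 + a4) + (b1 + b3 + b4)"
      "m (a2 + a3 + a4) + 2 * G \<le> m (a2 + a3) + m (a2 + a4) + m (a3 + a4) + (b2 + b3 + b4)"
proof -
  \<comment> \<open>Sortedness leaves only the pair sums \<open>a1 + a4\<close> and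
    \<open>a2 + a3\<close> incomparable, so the cases record which pair sums reach \<open>g\<close>.
    An affine switch such as \<open>G - b1 - b2\<close> on \<open>{1, 2}\<close> has the same total
    on any two complementary pairs, which guides the choices below.\<close>
  consider
    (A) "a1 + a4 \<le> g" "a2 + a3 \<le> g"
  | (B) "a1 + a4 \<le> g" "g \<le> a2 + a3"
  | (C) "g \<le> a1 + a4" "a2 + a3 \<le> g" "a1 + a2 + a3 \<le> g"
  | (C') "g \<le> a1 + a4" "a2 + a3 \<le> g" "g \<le> a1 + a2 + a3" "a4 \<le> a2 + a3"
  | (C'') "g \<le> a1 + a4" "a2 + a3 \<le> g" "g \<le> a1 + a2 + a3" "a2 + a3 \<le> a4"
  | (D1) "g \<le> a1 + a4" "g \<le> a2 + a3" "g \<le> a1 + a2"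
  | (D2) "g \<le> a1 + a4" "g \<le> a2 + a3" "a1 + a2 \<le> g" "g \<le> a1 + a3"
  | (D3) "g \<le> a1 + a4" "g \<le> a2 + a3" "a1 + a3 \<le> g"
    by linarith
  then show thesis
  proof cases
    case A
    show thesis
      by (rule that[of 0 0 0 0 0]) (use sorted A in \<open>simp_all add: m_def min_def\<close>)
  next
    case B
    \<comment> \<open>The pairs inside \<open>{2, 3, 4}\<close> reach \<open>g\<close>. The switch
      is \<open>-p\<close> on them, with \<open>p\<close> their least excess, and zero on the pairs
      containing index 1.\<close>
    define p where "p = a2 + a3 - g"
    show thesis
      by (rule that[of p 0 p p p]) (use sorted B in \<open>simp_all add: m_def p_def min_def\<close>)
  next
    case C
    show thesis
      by (rule that[of 0 0 0 0 0]) (use sorted C in \<open>simp_all add: m_def min_def\<close>)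
  next
    case C'
    \<comment> \<open>The pairs containing index 4 reach \<open>g\<close>. The switch is
      \<open>-p\<close> on them and zero on the others, where \<open>p\<close> is the smaller of
      \<open>a1 + a4 - g\<close> and \<open>a1 + a2 + a3 - g\<close>; this case and the next differ
      in which one is smaller.\<close>
    define p where "p = a1 + a4 - g"
    show thesis
      by (rule that[of "2*p" p p p "2*p"]) (use sorted C' in \<open>simp_all add: m_def p_def min_def\<close>)
  next
    case C''
    define p where "p = a1 + a2 + a3 - g"
    show thesis
      by (rule that[of "2*p" p p p "2*p"]) (use sorted C'' in \<open>simp_all add: m_def p_def min_def\<close>)
  next
    case D1
    show thesis
      \<comment> \<open>All pairs reach \<open>g\<close>, so the threshold function itself serves as
        the switch.\<close>
      by (rule that[of g a1 a2 a3 a4]) (use sorted D1 in \<open>simp_all add: m_def min_def\<close>)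
  next
    case D2
    \<comment> \<open>The switch agrees with the threshold function on every pair except
      \<open>{3, 4}\<close>, where equal totals on complementary pairs force its value.\<close>
    define s where "s = a1 + a2 - g"
    show thesis
      by (rule that[of "a1 + a2" a1 a2 "s + a3" "s + a4"]) (use sorted D2 in \<open>simp_all add: m_def s_def min_def\<close>)
  next
    case D3
    \<comment> \<open>The switch agrees with the threshold function on \<open>{1, 2}\<close>,
      \<open>{1, 3}\<close>, \<open>{1, 4}\<close> and \<open>{2, 3}\<close>; equal totals fix its
      values on \<open>{2, 4}\<close> and \<open>{3, 4}\<close>.\<close>
    define s where "s = a1 + a2 + a3 - g"
    show thesis
      by (rule that[of "a1 + s" a1 s s "a1 + s + a4 - g"]) (use sorted D3 in \<open>simp_all add: m_def s_def min_def\<close>)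
  qed
qed

text \<open>As a rewrite rule it splits a claim about all subsets of \<open>{i, j, k, l}\<close>
  into sixteen explicit instances.\<close>

lemma all_subsets_insert:
  "(\<forall>S\<subseteq>insert a A. P S) \<longleftrightarrow> (\<forall>S\<subseteq>A. P S \<and> P (insert a S))"
proof -
  have "(\<forall>S\<in>Pow (insert a A). P S) \<longleftrightarrow> (\<forall>S\<in>Pow A. P S \<and> P (insert a S))"
    unfolding Pow_insert by blast
  then show ?thesis unfolding Ball_def Pow_iff .
qed

section \<open>Closure properties of \<open>F2\<close>\<close>

lemma order_le_2_add:
  assumes "order_le_2 V f" "order_le_2 V h"
  shows "order_le_2 V (\<lambda>x. f x + h x)"
proof -
  from assms(1) obtain c a b where "\<forall>x\<subseteq>V. f x = quad_poly V c a b x"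
    unfolding order_le_2_def by blast
  moreover from assms(2) obtain c' a' b' where "\<forall>x\<subseteq>V. h x = quad_poly V c' a' b' x"
    unfolding order_le_2_def by blast
  ultimately have "\<forall>x\<subseteq>V. f x + h x = quad_poly V (c + c') (\<lambda>i. a i + a' i) (\<lambda>e. b e + b' e) x"
    by (simp add: quad_poly_def sum.distrib algebra_simps)
  then show ?thesis unfolding order_le_2_def by blast
qed

lemma F2_add:
  assumes "f \<in> F2 V" "h \<in> F2 V"
  shows "(\<lambda>x. f x + h x) \<in> F2 V"
proof -
  have "submodular_on V (\<lambda>x. f x + h x)"
    using assms unfolding F2_def submodular_on_def by (smt (verit) mem_Collect_eq)
  then show ?thesis
    using assms order_le_2_add unfolding F2_def by blast
qed

lemma F2_cong:
  assumes "\<And>x. x \<subseteq> V \<Longrightarrow> f x = h x"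
  shows "f \<in> F2 V \<longleftrightarrow> h \<in> F2 V"
proof -
  have eq: "\<forall>x\<subseteq>V. f x = h x" using assms by blast
  then have "order_le_2 V f \<longleftrightarrow> order_le_2 V h"
    unfolding order_le_2_def by simp
  then show ?thesis
    using submodular_on_cong[OF eq] unfolding F2_def by simp
qed

lemma F2_const: "(\<lambda>x. c) \<in> F2 V"
proof -
  have "\<forall>x\<subseteq>V. c = quad_poly V c (\<lambda>_. 0) (\<lambda>_. 0) x" by (simp add: quad_poly_def)
  then show ?thesis unfolding F2_def order_le_2_def submodular_on_def by blast
qed

lemma F2_sum:
  assumes "\<And>i. i \<in> I \<Longrightarrow> f i \<in> F2 V"
  shows "(\<lambda>x. \<Sum>i\<in>I. f i x) \<in> F2 V"
  using assms by (induction I rule: infinite_finite_induct) (simp_all add: F2_const F2_add)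

lemma F2_indicator:
  assumes "finite V" "i \<in> V"
  shows "(\<lambda>x. c * indicator x i) \<in> F2 V"
proof -
  have "c * indicator x i = quad_poly V 0 (\<lambda>j. if j = i then c else 0) (\<lambda>_. 0) x" for x
    using assms by (simp add: quad_poly_def if_distrib[of "\<lambda>t. t * _"] cong: if_cong)
  then show ?thesis
    unfolding F2_iff[OF assms(1)]
    by (intro exI[of _ 0] exI[of _ "\<lambda>j. if j = i then c else 0"] exI[of _ "\<lambda>_. 0"]) simp
qed

lemma F2_indicator_mult:
  assumes "finite V" "i \<in> V" "j \<in> V" "i \<noteq> j" "c \<le> 0"
  shows "(\<lambda>x. c * (indicator x i * indicator x j)) \<in> F2 V"
proof -
  let ?b = "\<lambda>e. if e = {i, j} then c else 0"
  have "c * (indicator x i * indicator x j) = quad_poly V 0 (\<lambda>_. 0) ?b x" for x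
    using assms by (simp add: quad_poly_def if_distrib[of "\<lambda>t. t * _"] cong: if_cong)
  moreover have "\<forall>e\<subseteq>V. card e = 2 \<longrightarrow> ?b e \<le> 0"
    using assms by simp
  ultimately show ?thesis
    unfolding F2_iff[OF assms(1)]
    by (intro exI[of _ 0] exI[of _ "\<lambda>_. 0"] exI[of _ ?b]) simp
qed

lemma F2_affine:
  assumes "finite V"
  shows "(\<lambda>x. c + sum f x) \<in> F2 V"
proof -
  have "(\<lambda>x. c + (\<Sum>i\<in>V. f i * indicator x i)) \<in> F2 V"
    using assms by (intro F2_add F2_const F2_sum F2_indicator)
  then show ?thesis
    using assms by (subst F2_cong[where h = "\<lambda>x. c + (\<Sum>i\<in>V. f i * indicator x i)"])
      (simp_all add: sum_mult_indicator Int_absorb1)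
qed

section \<open>Functions realised by two switches\<close>

text \<open>The target form with both auxiliary variables minimised out: \<open>G - sum f S\<close>
  is the coefficient of the forward variable at the labeling \<open>S\<close>, and
  \<open>H - sum b S\<close> that of the backward one.\<close>

definition reducible :: "'v set \<Rightarrow> ('v set \<Rightarrow> real) \<Rightarrow> bool" where
  "reducible V m \<longleftrightarrow> (\<exists>q\<in>F2 V. \<exists>G f H b. (\<forall>i\<in>V. 0 \<le> f i \<and> 0 \<le> b i)
    \<and> (\<forall>S\<subseteq>V. (card S \<le> 2 \<longrightarrow> sum f S \<le> G) \<and> (3 \<le> card S \<longrightarrow> G \<le> sum f S)
         \<and> (card S \<le> 1 \<longrightarrow> sum b S \<le> H) \<and> (2 \<le> card S \<longrightarrow> H \<le> sum b S)
         \<and> m S = q S + min 0 (G - sum f S) + min 0 (H - sum b S)))"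

lemma reducibleI:
  assumes "q \<in> F2 V" "\<And>i. i \<in> V \<Longrightarrow> 0 \<le> f i \<and> 0 \<le> b i"
    and "\<And>S. S \<subseteq> V \<Longrightarrow> (card S \<le> 2 \<longrightarrow> sum f S \<le> G) \<and> (3 \<le> card S \<longrightarrow> G \<le> sum f S)
         \<and> (card S \<le> 1 \<longrightarrow> sum b S \<le> H) \<and> (2 \<le> card S \<longrightarrow> H \<le> sum b S)
         \<and> m S = q S + min 0 (G - sum f S) + min 0 (H - sum b S)"
  shows "reducible V m"
  unfolding reducible_def
  by (rule bexI[OF _ assms(1)], rule exI[of _ G], rule exI[of _ f], rule exI[of _ H],
      rule exI[of _ b], intro conjI ballI allI impI) (simp_all add: assms(2,3))

lemma reducible_cong:
  assumes "\<And>S. S \<subseteq> V \<Longrightarrow> m S = m' S"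
  shows "reducible V m \<longleftrightarrow> reducible V m'"
  using assms unfolding reducible_def by (intro bex_cong ex_cong1 refl conj_cong) auto

lemma F2_reducible:
  assumes "m \<in> F2 V"
  shows "reducible V m"
  by (rule reducibleI[OF assms, of "\<lambda>_. 0" "\<lambda>_. 0" 0 0]) simp_all

text \<open>\<open>min 0\<close> is additive on two numbers of the same weak sign, and the
  cardinality of \<open>S\<close> alone fixes the sign of both forward switches, and likewise of
  both backward switches.\<close>

lemma reducible_add:
  assumes "reducible V m" "reducible V m'"
  shows "reducible V (\<lambda>S. m S + m' S)"
proof -
  from assms(1) obtain q G f H b where q: "q \<in> F2 V" and nn: "\<forall>i\<in>V. 0 \<le> f i \<and> 0 \<le> b i"
    and m: "\<And>S. S \<subseteq> V \<Longrightarrow> (card S \<le> 2 \<longrightarrow> sum f S \<le> G) \<and> (3 \<le> card S \<longrightarrow> G \<le> sum f S)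
         \<and> (card S \<le> 1 \<longrightarrow> sum b S \<le> H) \<and> (2 \<le> card S \<longrightarrow> H \<le> sum b S)
         \<and> m S = q S + min 0 (G - sum f S) + min 0 (H - sum b S)"
    unfolding reducible_def by metis
  from assms(2) obtain q' G' f' H' b' where q': "q' \<in> F2 V" and nn': "\<forall>i\<in>V. 0 \<le> f' i \<and> 0 \<le> b' i"
    and m': "\<And>S. S \<subseteq> V \<Longrightarrow> (card S \<le> 2 \<longrightarrow> sum f' S \<le> G') \<and> (3 \<le> card S \<longrightarrow> G' \<le> sum f' S)
         \<and> (card S \<le> 1 \<longrightarrow> sum b' S \<le> H') \<and> (2 \<le> card S \<longrightarrow> H' \<le> sum b' S)
         \<and> m' S = q' S + min 0 (G' - sum f' S) + min 0 (H' - sum b' S)"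
    unfolding reducible_def by metis
  let ?f = "\<lambda>i. f i + f' i" and ?b = "\<lambda>i. b i + b' i"
  have "(card S \<le> 2 \<longrightarrow> sum ?f S \<le> G + G') \<and> (3 \<le> card S \<longrightarrow> G + G' \<le> sum ?f S)
      \<and> (card S \<le> 1 \<longrightarrow> sum ?b S \<le> H + H') \<and> (2 \<le> card S \<longrightarrow> H + H' \<le> sum ?b S)
      \<and> m S + m' S = (q S + q' S) + min 0 (G + G' - sum ?f S) + min 0 (H + H' - sum ?b S)"
    if "S \<subseteq> V" for S
  proof -
    have *: "min 0 (x + x') = min 0 x + min 0 x'"
      if "0 \<le> x \<and> 0 \<le> x' \<or> x \<le> 0 \<and> x' \<le> 0" for x x' :: real
      using that by (auto simp: min_def)
    have "min 0 (G - sum f S + (G' - sum f' S)) = min 0 (G - sum f S) + min 0 (G' - sum f' S)"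
      using m[OF that] m'[OF that] by (intro *) (cases "card S \<le> 2"; force)
    moreover have "min 0 (H - sum b S + (H' - sum b' S)) = min 0 (H - sum b S) + min 0 (H' - sum b' S)"
      using m[OF that] m'[OF that] by (intro *) (cases "card S \<le> 1"; force)
    ultimately have "m S + m' S
        = (q S + q' S) + min 0 (G + G' - sum ?f S) + min 0 (H + H' - sum ?b S)"
      using m[OF that] m'[OF that] by (simp add: sum.distrib algebra_simps)
    moreover have "(card S \<le> 2 \<longrightarrow> sum ?f S \<le> G + G') \<and> (3 \<le> card S \<longrightarrow> G + G' \<le> sum ?f S)
        \<and> (card S \<le> 1 \<longrightarrow> sum ?b S \<le> H + H') \<and> (2 \<le> card S \<longrightarrow> H + H' \<le> sum ?b S)"
      unfolding sum.distrib using m[OF that] m'[OF that] by (intro conjI impI add_mono) simp_all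
    ultimately show ?thesis by blast
  qed
  then show ?thesis
    using nn nn' by (intro reducibleI[OF F2_add[OF q q'], of ?f ?b "G + G'" "H + H'"]) auto
qed

lemma reducible_sum:
  assumes "\<And>l. l \<in> L \<Longrightarrow> reducible V (m l)"
  shows "reducible V (\<lambda>S. \<Sum>l\<in>L. m l S)"
  using assms
  by (induction L rule: infinite_finite_induct) (simp_all add: F2_reducible F2_const reducible_add)

section \<open>Reduction of a single threshold function\<close>

text \<open>The construction goes by degree: bilinear terms repair the difference to the backward
  switch on pairs, and the forward switch repairs triples and the full set. Smaller sets need no
  repair because no weight exceeds \<open>g\<close>.\<close>

lemma reducible_threshold_sorted:
  fixes a :: "'v \<Rightarrow> real"
  assumes dist: "distinct [i, j, k, l]"
    and sorted: "0 \<le> a i" "a i \<le> a j" "a j \<le> a k" "a k \<le> a l" "a l \<le> g"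
  shows "reducible {i, j, k, l} (\<lambda>S. min 0 (g - sum a S))"
proof -
  let ?V = "{i, j, k, l}"
  have neq: "i \<noteq> j" "i \<noteq> k" "i \<noteq> l" "j \<noteq> k" "j \<noteq> l" "k \<noteq> l"
    "j \<noteq> i" "k \<noteq> i" "l \<noteq> i" "k \<noteq> j" "l \<noteq> j" "l \<noteq> k"
    using dist by auto
  define m where "m s = min 0 (g - s)" for s
  have m_single: "m 0 = 0" "m (a i) = 0" "m (a j) = 0" "m (a k) = 0" "m (a l) = 0"
    using sorted by (simp_all add: m_def)
  obtain H b1 b2 b3 b4 where b:
    "H \<le> b1 + b2" "H \<le> b1 + b3" "H \<le> b1 + b4" "H \<le> b2 + b3" "H \<le> b2 + b4" "H \<le> b3 + b4"
    "b1 \<le> H" "b2 \<le> H" "b3 \<le> H" "b4 \<le> H"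
    and pairs:
      "m (a i + a j) \<le> H - b1 - b2" "m (a i + a k) \<le> H - b1 - b3"
      "m (a i + a l) \<le> H - b1 - b4" "m (a j + a k) \<le> H - b2 - b3"
      "m (a j + a l) \<le> H - b2 - b4" "m (a k + a l) \<le> H - b3 - b4"
    and quadruple:
      "m (a i + a j + a k + a l) + m (a k + a l) + (H - b1 - b2) \<le> m (a j + a k + a l) + m (a i + a k + a l) + m (a i + a j)"
      "m (a i + a j + a k + a l) + m (a j + a l) + (H - b1 - b3) \<le> m (a j + a k + a l) + m (a i + a j + a l) + m (a i + a k)"
      "m (a i + a j + a k + a l) + m (a j + a k) + (H - b1 - b4) \<le> m (a j + a k + a l) + m (a i + a j + a k) + m (a i + a l)"
      "m (a i + a j + a k + a l) + m (a i + a l) + (H - b2 - b3) \<le> m (a i + a k + a l) + m (a i + a j + a l) + m (a j + a k)"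
      "m (a i + a j + a k + a l) + m (a i + a k) + (H - b2 - b4) \<le> m (a i + a k + a l) + m (a i + a j + a k) + m (a j + a l)"
      "m (a i + a j + a k + a l) + m (a i + a j) + (H - b3 - b4) \<le> m (a i + a j + a l) + m (a i + a j + a k) + m (a k + a l)"
    and triples:
      "m (a i + a j + a k) + 2 * H \<le> m (a i + a j) + m (a i + a k) + m (a j + a k) + (b1 + b2 + b3)"
      "m (a i + a j + a l) + 2 * H \<le> m (a i + a j) + m (a i + a l) + m (a j + a l) + (b1 + b2 + b4)"
      "m (a i + a k + a l) + 2 * H \<le> m (a i + a k) + m (a i + a l) + m (a k + a l) + (b1 + b3 + b4)"
      "m (a j + a k + a l) + 2 * H \<le> m (a j + a k) + m (a j + a l) + m (a k + a l) + (b2 + b3 + b4)"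
    by (rule backward_affine[OF sorted, folded m_def])
  \<comment> \<open>What is left of the threshold function on the triples and on the full set after subtracting
    the backward switch and the quadratic part that makes the remainder vanish on the pairs.\<close>
  define r1 where "r1 = m (a j + a k + a l) - m (a j + a k) - m (a j + a l) - m (a k + a l) + 2 * H - b2 - b3 - b4"
  define r2 where "r2 = m (a i + a k + a l) - m (a i + a k) - m (a i + a l) - m (a k + a l) + 2 * H - b1 - b3 - b4"
  define r3 where "r3 = m (a i + a j + a l) - m (a i + a j) - m (a i + a l) - m (a j + a l) + 2 * H - b1 - b2 - b4"
  define r4 where "r4 = m (a i + a j + a k) - m (a i + a j) - m (a i + a k) - m (a j + a k) + 2 * H - b1 - b2 - b3"
  define r where "r = m (a i + a j + a k + a l) - m (a i + a j) - m (a i + a k) - m (a i + a l)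
      - m (a j + a k) - m (a j + a l) - m (a k + a l) + 5 * H - 2 * b1 - 2 * b2 - 2 * b3 - 2 * b4"
  \<comment> \<open>In \<open>r1 + r2 - r\<close> all pair values of \<open>m\<close> cancel except
    those of \<open>{i, j}\<close> and \<open>{k, l}\<close>, and \<open>H - b1 - b2\<close> remains
    with a minus sign; this is the first inequality of \<open>quadruple\<close>. The others arise in
    the same way.\<close>
  have r: "r1 \<le> 0" "r2 \<le> 0" "r3 \<le> 0" "r4 \<le> 0"
    "r \<le> r1 + r2" "r \<le> r1 + r3" "r \<le> r1 + r4" "r \<le> r2 + r3" "r \<le> r2 + r4" "r \<le> r3 + r4"
    using triples quadruple unfolding r1_def r2_def r3_def r4_def r_def by linarith+
  obtain f1 f2 f3 f4 G where f: "0 \<le> f1" "0 \<le> f2" "0 \<le> f3" "0 \<le> f4"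
      "f1 + f2 \<le> G" "f1 + f3 \<le> G" "f1 + f4 \<le> G" "f2 + f3 \<le> G" "f2 + f4 \<le> G" "f3 + f4 \<le> G"
    and G: "G - f2 - f3 - f4 = r1" "G - f1 - f3 - f4 = r2" "G - f1 - f2 - f4 = r3"
      "G - f1 - f2 - f3 = r4" "G - f1 - f2 - f3 - f4 = r"
    by (rule forward_affine[OF r])
  define F where "F x = (if x = i then f1 else if x = j then f2 else if x = k then f3 else f4)" for x
  define B where "B x = (if x = i then b1 else if x = j then b2 else if x = k then b3 else b4)" for x
  have F: "F i = f1" "F j = f2" "F k = f3" "F l = f4" and B: "B i = b1" "B j = b2" "B k = b3" "B l = b4"
    using dist by (auto simp: F_def B_def)
  \<comment> \<open>The bilinear coefficient of a pair is the threshold function minus the backward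
    switch there, as the forward switch contributes nothing on pairs.\<close>
  define e where "e s t = m (a s + a t) - (H - B s - B t)" for s t
  define q :: "'v set \<Rightarrow> real" where "q S =
    e i j * (indicator S i * indicator S j) +
    e i k * (indicator S i * indicator S k) +
    e i l * (indicator S i * indicator S l) +
    e j k * (indicator S j * indicator S k) +
    e j l * (indicator S j * indicator S l) +
    e k l * (indicator S k * indicator S l)" for S
  have e_le: "e i j \<le> 0" "e i k \<le> 0" "e i l \<le> 0" "e j k \<le> 0" "e j l \<le> 0" "e k l \<le> 0"
    using pairs by (simp_all add: e_def B)
  have q: "q \<in> F2 ?V"
    unfolding q_def using dist e_le by (intro F2_add F2_indicator_mult) auto
  have nonneg: "\<forall>x\<in>?V. 0 \<le> F x \<and> 0 \<le> B x"
    using f b by (simp add: F B)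
  have signs: "\<forall>S\<subseteq>?V. (card S \<le> 2 \<longrightarrow> sum F S \<le> G) \<and> (3 \<le> card S \<longrightarrow> G \<le> sum F S)
      \<and> (card S \<le> 1 \<longrightarrow> sum B S \<le> H) \<and> (2 \<le> card S \<longrightarrow> H \<le> sum B S)"
    using f b r G by (simp add: neq all_subsets_insert F B)
  \<comment> \<open>With cardinality tests in place of minima, the instances become linear
    equations; those for triples and the full set are the equations \<open>G\<close>.\<close>
  have "\<forall>S\<subseteq>?V. m (sum a S) = q S + (if 3 \<le> card S then G - sum F S else 0)
      + (if 2 \<le> card S then H - sum B S else 0)"
    by (simp add: neq m_single all_subsets_insert q_def e_def F B indicator_def add.assoc)
      (intro conjI; use G[unfolded r1_def r2_def r3_def r4_def r_def add.assoc] in linarith)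
  moreover have "min 0 (G - sum F S) = (if 3 \<le> card S then G - sum F S else 0)"
    "min 0 (H - sum B S) = (if 2 \<le> card S then H - sum B S else 0)" if "S \<subseteq> ?V" for S
  proof -
    have "3 \<le> card S \<or> card S \<le> 2" "2 \<le> card S \<or> card S \<le> 1" by linarith+
    then show "min 0 (G - sum F S) = (if 3 \<le> card S then G - sum F S else 0)"
      "min 0 (H - sum B S) = (if 2 \<le> card S then H - sum B S else 0)"
      using signs[rule_format, OF that] by fastforce+
  qed
  ultimately have eq: "min 0 (g - sum a S) = q S + min 0 (G - sum F S) + min 0 (H - sum B S)"
    if "S \<subseteq> ?V" for S
    using that unfolding m_def by simp
  show ?thesis
    by (rule reducibleI[OF q, of F B G H]) (use nonneg signs eq in blast)+
qed

text \<open>If some weight in \<open>S\<close> exceeds \<open>g\<close>, its clipped value is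
  \<open>g\<close>, so the clipped sum already reaches \<open>g\<close> and both minima are linear
  there. Otherwise clipping changes nothing. The correction is a sum over \<open>S\<close>, hence
  affine.\<close>

lemma threshold_clip:
  fixes a :: "'v \<Rightarrow> real"
  assumes "finite S" "0 \<le> g" "\<And>i. i \<in> S \<Longrightarrow> 0 \<le> a i"
  shows "min 0 (g - sum a S) = min 0 (g - (\<Sum>i\<in>S. min (a i) g)) - (\<Sum>i\<in>S. max 0 (a i - g))"
proof (cases "\<forall>i\<in>S. a i \<le> g")
  case True
  then have "(\<Sum>i\<in>S. max 0 (a i - g)) = 0"
    by (intro sum.neutral) simp
  then show ?thesis using True by (simp add: min_def)
next
  case False
  then obtain i where i: "i \<in> S" "g < a i" by force
  have "min (a i) g \<le> (\<Sum>i\<in>S. min (a i) g)"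
    using assms i by (intro member_le_sum) auto
  moreover have "sum a S = (\<Sum>i\<in>S. min (a i) g) + (\<Sum>i\<in>S. max 0 (a i - g))"
    unfolding sum.distrib[symmetric] by (intro sum.cong) auto
  moreover have "0 \<le> (\<Sum>i\<in>S. max 0 (a i - g))"
    by (intro sum_nonneg) simp
  ultimately show ?thesis using i by linarith
qed

lemma reducible_threshold:
  fixes a :: "'v \<Rightarrow> real"
  assumes V: "card V = 4" and a: "\<And>i. i \<in> V \<Longrightarrow> 0 \<le> a i"
  shows "reducible V (\<lambda>S. min 0 (g - sum a S))"
proof (cases "0 \<le> g")
  case True
  have fin: "finite V" using V card.infinite by force
  define c where "c i = min (a i) g" for i
  obtain ys where ys: "set ys = V" "distinct ys"
    using finite_distinct_list[OF fin] by blast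
  define xs where "xs = sort_key c ys"
  have xs: "set xs = V" "distinct xs" "sorted (map c xs)"
    using ys by (simp_all add: xs_def)
  then have "length xs = 4"
    using V distinct_card by metis
  then obtain i j k l where ijkl: "xs = [i, j, k, l]"
    by (auto simp: numeral_eq_Suc length_Suc_conv)
  have "reducible {i, j, k, l} (\<lambda>S. min 0 (g - sum c S))"
    using xs a True unfolding ijkl by (intro reducible_threshold_sorted) (auto simp: c_def)
  moreover have "{i, j, k, l} = V" using xs ijkl by simp
  \<comment> \<open>The summand \<open>0\<close> gives the clipping correction the shape required by
    \<open>F2_affine\<close>.\<close>
  ultimately have "reducible V (\<lambda>S. min 0 (g - sum c S) + (0 + (\<Sum>i\<in>S. - max 0 (a i - g))))"
    using reducible_add F2_reducible F2_affine fin by metis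
  moreover have "min 0 (g - sum a S) = min 0 (g - sum c S) + (0 + (\<Sum>i\<in>S. - max 0 (a i - g)))"
    if "S \<subseteq> V" for S
    using threshold_clip[of S g a] that fin a True finite_subset[of S V]
    unfolding c_def sum_negf by (simp add: subset_iff)
  ultimately show ?thesis
    using reducible_cong[of V "\<lambda>S. min 0 (g - sum a S)"] by simp
next
  case False
  have fin: "finite V" using V card.infinite by force
  \<comment> \<open>For negative \<open>g\<close> and non-negative weights the switch is on at every
    labeling, so the threshold function is affine.\<close>
  have "min 0 (g - sum a S) = g + (\<Sum>i\<in>S. - a i)" if "S \<subseteq> V" for S
  proof -
    have "0 \<le> sum a S" using a that by (intro sum_nonneg) auto
    then show ?thesis using False by (simp add: sum_negf)
  qed
  moreover have "reducible V (\<lambda>S. g + (\<Sum>i\<in>S. - a i))"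
    using fin by (intro F2_reducible F2_affine)
  ultimately show ?thesis
    using reducible_cong[of V "\<lambda>S. min 0 (g - sum a S)"] by simp
qed

section \<open>Minimisation over auxiliary variables and joint membership in
  \<open>F2\<close>\<close>

text \<open>Without products of auxiliary variables the minimum separates into one choice per
  variable; switching on exactly the non-positive coefficients attains it.\<close>

lemma MIN_switches:
  fixes w :: "'l \<Rightarrow> real"
  assumes L: "finite L"
  shows "(MIN z\<in>Pow L. c + (\<Sum>l\<in>L. w l * indicator z l)) = c + (\<Sum>l\<in>L. min 0 (w l))"
proof (rule Min_eqI)
  show "c + (\<Sum>l\<in>L. min 0 (w l)) \<le> y"
    if "y \<in> (\<lambda>z. c + (\<Sum>l\<in>L. w l * indicator z l)) ` Pow L" for y
    using that by (auto simp: indicator_def intro!: sum_mono)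
  have "(\<Sum>l\<in>L. min 0 (w l)) = (\<Sum>l\<in>L. w l * indicator {l \<in> L. w l \<le> 0} l)"
    by (intro sum.cong) (auto simp: indicator_def)
  then show "c + (\<Sum>l\<in>L. min 0 (w l)) \<in> (\<lambda>z. c + (\<Sum>l\<in>L. w l * indicator z l)) ` Pow L"
    by (intro image_eqI[of _ _ "{l \<in> L. w l \<le> 0}"]) auto
qed (use L in simp)

lemma indicator_vimage: "indicator (f -` u) i = indicator u (f i)"
  by (simp add: indicator_def)

text \<open>The polynomial of \<open>q\<close> is read in the variables \<open>Inl i\<close> with
  unchanged coefficients, so its bilinear ones stay non-positive.\<close>

lemma F2_left_block:
  assumes fin: "finite V" "finite W" and "q \<in> F2 V"
  shows "(\<lambda>u. q (Inl -` u)) \<in> F2 (V <+> W)"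
proof -
  obtain c a b where b: "\<forall>e\<subseteq>V. card e = 2 \<longrightarrow> b e \<le> 0"
    and q: "\<forall>x\<subseteq>V. q x = quad_poly V c a b x"
    using assms(3) unfolding F2_iff[OF fin(1)] by blast
  have "(\<lambda>u. b e * (\<Prod>i\<in>e. indicator u (Inl i))) \<in> F2 (V <+> W)" if "e \<subseteq> V" "card e = 2" for e
  proof -
    obtain i j where e: "e = {i, j}" "i \<noteq> j" using \<open>card e = 2\<close> by (auto simp: card_2_iff)
    then have "(\<lambda>u. b e * (indicator u (Inl i) * indicator u (Inl j))) \<in> F2 (V <+> W)"
      using fin b that by (intro F2_indicator_mult) auto
    then show ?thesis using e by simp
  qed
  then have "(\<lambda>u. quad_poly V c a b (Inl -` u)) \<in> F2 (V <+> W)"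
    unfolding quad_poly_def indicator_vimage
    using fin by (intro F2_add F2_const F2_sum F2_indicator) auto
  moreover have "q (Inl -` u) = quad_poly V c a b (Inl -` u)" if "u \<subseteq> V <+> W" for u
  proof -
    have "Inl -` u \<subseteq> V" using that by auto
    then show ?thesis using q by blast
  qed
  ultimately show ?thesis
    using F2_cong[of "V <+> W" "\<lambda>u. q (Inl -` u)"] by simp
qed

text \<open>Multiplying out leaves a linear term in \<open>Inr w\<close> and bilinear coefficients
  \<open>- f i\<close>, non-positive by the assumption on \<open>f\<close>.\<close>

lemma F2_switch:
  assumes fin: "finite V" "finite W" and "w \<in> W" "\<And>i. i \<in> V \<Longrightarrow> 0 \<le> f i"
  shows "(\<lambda>u. (c - (\<Sum>i\<in>V. f i * indicator (Inl -` u) i)) * indicator (Inr -` u) w) \<in> F2 (V <+> W)"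
proof -
  have "(c - (\<Sum>i\<in>V. f i * indicator (Inl -` u) i)) * indicator (Inr -` u) w
      = c * indicator u (Inr w) + (\<Sum>i\<in>V. - f i * (indicator u (Inl i) * indicator u (Inr w)))" for u
    by (simp add: indicator_vimage left_diff_distrib sum_distrib_right sum_negf mult.assoc)
  moreover have "(\<lambda>u. c * indicator u (Inr w)
      + (\<Sum>i\<in>V. - f i * (indicator u (Inl i) * indicator u (Inr w)))) \<in> F2 (V <+> W)"
    using assms by (intro F2_add F2_sum F2_indicator F2_indicator_mult) auto
  ultimately show ?thesis by simp
qed

theorem theorem3:
  fixes k :: nat
    and h :: "nat set \<Rightarrow> nat set \<Rightarrow> real"
    and q :: "nat set \<Rightarrow> real"
    and g :: "nat \<Rightarrow> real"
    and gi :: "nat \<Rightarrow> nat \<Rightarrow> real"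
  assumes "joint h \<in> F2 ({1..4} <+> {1..k})"
    and "q \<in> F2 {1..4}"
    and "\<forall>l\<in>{1..k}. \<forall>i\<in>{1..4}. gi l i \<ge> 0"
    and "\<forall>x\<subseteq>{1..4}. \<forall>z\<subseteq>{1..k}.
           h x z = q x + (\<Sum>l=1..k. (g l - (\<Sum>i=1..4. gi l i * indicator x i)) * indicator z l)"
  shows "\<exists>(q' :: nat set \<Rightarrow> real) (gf :: real) (gfi :: nat \<Rightarrow> real) (gb :: real) (gbi :: nat \<Rightarrow> real).
    let \<kappa>f = (\<lambda>x. gf - (\<Sum>i=1..4. gfi i * indicator x i));
        \<kappa>b = (\<lambda>x. gb - (\<Sum>i=1..4. gbi i * indicator x i));
        h' = (\<lambda>x z. q' x + \<kappa>f x * indicator z Fwd + \<kappa>b x * indicator z Bwd)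
    in q' \<in> F2 {1..4}
     \<and> (\<forall>i\<in>{1..4}. gfi i \<ge> 0 \<and> gbi i \<ge> 0)
     \<and> joint h' \<in> F2 ({1..4} <+> {Fwd, Bwd})
     \<and> (\<forall>x\<subseteq>{1..4}. (MIN z\<in>Pow {Fwd, Bwd}. h' x z) = (MIN z\<in>Pow {1..k}. h x z))
     \<and> (\<forall>S\<subseteq>{1..4}. card S \<le> 2 \<longrightarrow> \<kappa>f S \<ge> 0)
     \<and> (\<forall>S\<subseteq>{1..4}. card S \<ge> 3 \<longrightarrow> \<kappa>f S \<le> 0)
     \<and> (\<forall>S\<subseteq>{1..4}. card S \<le> 1 \<longrightarrow> \<kappa>b S \<ge> 0)
     \<and> (\<forall>S\<subseteq>{1..4}. card S \<ge> 2 \<longrightarrow> \<kappa>b S \<le> 0)"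
proof -
  let ?V = "{1..4} :: nat set"
  have ind: "(\<Sum>i=1..4. f i * indicator x i) = sum f x" if "x \<subseteq> ?V" for f :: "nat \<Rightarrow> real" and x
    using that by (simp add: sum_mult_indicator Int_absorb1)
  \<comment> \<open>This is \<open>h\<close> minimised over its auxiliary variables; it is a member
    of \<open>F2\<close> plus threshold functions and so falls under
    \<open>reducible\<close>.\<close>
  define m where "m x = q x + (\<Sum>l=1..k. min 0 (g l - sum (gi l) x))" for x
  have min_h: "(MIN z\<in>Pow {1..k}. h x z) = m x" if x: "x \<subseteq> ?V" for x
  proof -
    have "(MIN z\<in>Pow {1..k}. h x z)
        = (MIN z\<in>Pow {1..k}. q x + (\<Sum>l=1..k. (g l - sum (gi l) x) * indicator z l))"
      using assms(4) x ind[OF x] by (intro arg_cong[where f = Min] image_cong) auto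
    then show ?thesis unfolding m_def MIN_switches[OF finite_atLeastAtMost] .
  qed
  have "reducible ?V m"
    unfolding m_def using assms(2,3)
    by (intro reducible_add reducible_sum reducible_threshold F2_reducible) auto
  then obtain q' G f H b where q': "q' \<in> F2 ?V"
    and nonneg: "\<And>i. i \<in> ?V \<Longrightarrow> 0 \<le> f i \<and> 0 \<le> b i"
    and red: "\<And>S. S \<subseteq> ?V \<Longrightarrow> (card S \<le> 2 \<longrightarrow> sum f S \<le> G) \<and> (3 \<le> card S \<longrightarrow> G \<le> sum f S)
         \<and> (card S \<le> 1 \<longrightarrow> sum b S \<le> H) \<and> (2 \<le> card S \<longrightarrow> H \<le> sum b S)
         \<and> m S = q' S + min 0 (G - sum f S) + min 0 (H - sum b S)"
    unfolding reducible_def by metis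
  let ?F = "\<lambda>x. G - (\<Sum>i=1..4. f i * indicator x i)"
  let ?B = "\<lambda>x. H - (\<Sum>i=1..4. b i * indicator x i)"
  let ?h = "\<lambda>x z. q' x + ?F x * indicator z Fwd + ?B x * indicator z Bwd"
  have joint: "joint ?h \<in> F2 (?V <+> {Fwd, Bwd})"
    unfolding joint_def using q' nonneg by (intro F2_add F2_left_block F2_switch) auto
  have minimum: "(MIN z\<in>Pow {Fwd, Bwd}. ?h x z) = (MIN z\<in>Pow {1..k}. h x z)" if x: "x \<subseteq> ?V" for x
  proof -
    \<comment> \<open>The general minimum formula is applied to the index set
      \<open>{Fwd, Bwd}\<close>, with \<open>case_aux\<close> supplying the two
      coefficients.\<close>
    have "(MIN z\<in>Pow {Fwd, Bwd}. ?h x z) = q' x + min 0 (?F x) + min 0 (?B x)"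
      using MIN_switches[of "{Fwd, Bwd}" "q' x" "case_aux (?F x) (?B x)"]
      by (simp add: add.assoc del: sum_mult_indicator sum_indicator_mult)
    then show ?thesis
      unfolding ind[OF x] using red[OF x] min_h[OF x] by linarith
  qed
  have "\<forall>S\<subseteq>?V. card S \<le> 2 \<longrightarrow> 0 \<le> ?F S" "\<forall>S\<subseteq>?V. 3 \<le> card S \<longrightarrow> ?F S \<le> 0"
    "\<forall>S\<subseteq>?V. card S \<le> 1 \<longrightarrow> 0 \<le> ?B S" "\<forall>S\<subseteq>?V. 2 \<le> card S \<longrightarrow> ?B S \<le> 0"
    using red by (simp_all add: ind del: One_nat_def sum_mult_indicator sum_indicator_mult)
  note signs = this
  have nonneg': "\<forall>i\<in>?V. 0 \<le> f i \<and> 0 \<le> b i"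
    using nonneg by (intro ballI)
  have minimum': "\<forall>x\<subseteq>?V. (MIN z\<in>Pow {Fwd, Bwd}. ?h x z) = (MIN z\<in>Pow {1..k}. h x z)"
    using minimum by (intro allI impI)
  show ?thesis
    unfolding Let_def
    by (rule exI[of _ q'], rule exI[of _ G], rule exI[of _ f], rule exI[of _ H],
        rule exI[of _ b], intro conjI) (fact q' nonneg' joint minimum' signs)+
qed

end
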